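(* Let $x_0\in\mathbf{R}^n$ satisfy $\sum_{i=1}^n x_{0,i}=0$, and let $(x_k)_{k\ge0}$ be the repeated averaging chain on $\mathbf{R}^n$ started from $x_0$. Let $S(k):=\sum_{i=1}^n x_{k,i}^2$ and $\tau:=1-\frac{1}{n-1}$. Then $\mathbb{E}(S(k))=\tau^k S(0)$. Moreover, $\lim_{k\to\infty}S(k)/\tau^k$ exists and is finite almost surely.
   Context: Repeated averaging chain on $\mathbf{R}^n$: given $x_k=(x_{k,1},\ldots,x_{k,n})$, pick two distinct coordinates $I,J\in\{1,\ldots,n\}$ uniformly at random (independently of the past), replace both $x_{k,I}$ and $x_{k,J}$ by $(x_{k,I}+x_{k,J})/2$, and keep all other coordinates the same; the result is $x_{k+1}$. Here $k\ge 0$ is an integer. *)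

theory Defs
  imports "HOL-Probability.Probability"
begin

definition average_pair :: "'n \<times> 'n \<Rightarrow> real ^ 'n \<Rightarrow> real ^ 'n::finite" where
  "average_pair p x =
     (\<chi> l. if l = fst p \<or> l = snd p then (x $ fst p + x $ snd p) / 2 else x $ l)"

text \<open>
  At step \<open>k\<close> the ordered pair \<open>pick k = (I, J)\<close> is uniform over the ordered pairs of distinct
  indices (\<^const>\<open>pmf_of_set\<close> is only meaningful here if there are at least two indices).
  The past at time \<open>k\<close> is the trajectory \<open>(X 0, \<dots>, X k)\<close>; an i.i.d. sequence of picks is a
  special case, since the trajectory is a function of \<open>pick 0, \<dots>, pick (k - 1)\<close>.
  Independence is that of the generated \<open>\<sigma>\<close>-algebras: the library's \<open>indep_var\<close> requires
  both random variables to have the same value type.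
\<close>

locale repeated_averaging_chain = prob_space M
  for M :: "'w measure" +
  fixes x0 :: "real ^ 'n::finite"
    and X :: "nat \<Rightarrow> 'w \<Rightarrow> real ^ 'n"
    and pick :: "nat \<Rightarrow> 'w \<Rightarrow> 'n \<times> 'n"
  assumes start: "\<omega> \<in> space M \<Longrightarrow> X 0 \<omega> = x0"
    and step: "\<omega> \<in> space M \<Longrightarrow> X (Suc k) \<omega> = average_pair (pick k \<omega>) (X k \<omega>)"
    and pick_measurable: "pick k \<in> measurable M (count_space UNIV)"
    and pick_uniform:
      "distr M (count_space UNIV) (pick k) = measure_pmf (pmf_of_set {(i, j). i \<noteq> j})"
    and pick_indep_past:
      "indep_set
         (sets (vimage_algebra (space M) (\<lambda>\<omega>. \<lambda>i\<in>{..k}. X i \<omega>) (\<Pi>\<^sub>M i\<in>{..k}. borel)))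
         (sets (vimage_algebra (space M) (pick k) (count_space UNIV)))"

end

(* With \<tau> = 1 - 1/(n-1): averaging the coordinates i and j lowers the sum of squares by
   (x_i - x_j)^2 / 2. For a vector of coordinate sum zero, the mean of this over a uniformly
   chosen pair is 1/(n-1) times the sum of squares, so S(k) / \<tau>^k is a nonnegative martingale
   and converges almost surely by Doob's upcrossing argument. For n = 2, \<tau> = 0, and division
   by zero makes the quotients vanish for k \<ge> 1. *)

theory Submission
  imports Defs
begin

section \<open>Upcrossings and convergence of a real sequence\<close>

text \<open>
  The state of the strategy that enters when \<open>y\<close> is at most \<open>a\<close> and leaves when it is at least \<open>b\<close>.
\<close>

primrec holding :: "real \<Rightarrow> real \<Rightarrow> (nat \<Rightarrow> real) \<Rightarrow> nat \<Rightarrow> bool" where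
  "holding a b y 0 \<longleftrightarrow> y 0 \<le> a"
| "holding a b y (Suc k) \<longleftrightarrow> (if holding a b y k then y (Suc k) < b else y (Suc k) \<le> a)"

text \<open>A passage is counted at the moment of exit, so one still under way contributes
  nothing.\<close>

primrec upcrossings :: "real \<Rightarrow> real \<Rightarrow> (nat \<Rightarrow> real) \<Rightarrow> nat \<Rightarrow> nat" where
  "upcrossings a b y 0 = 0"
| "upcrossings a b y (Suc k) =
     upcrossings a b y k + (if holding a b y k \<and> b \<le> y (Suc k) then 1 else 0)"

text \<open>Invariant of the trading strategy. A completed passage enters at most at
  \<open>a\<close> and leaves at least at \<open>b\<close>, so it earns at least
  \<open>b - a\<close>; an open position entered at most at \<open>a\<close> has earned at least
  \<open>y n - a\<close>. The constant \<open>a\<close> added on both sides turns this into one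
  inequality whether or not a position is open.\<close>

lemma upcrossings_gain:
  assumes "a < b"
  shows "(b - a) * upcrossings a b y n + (if holding a b y n then y n else a)
    \<le> a + (\<Sum>k<n. of_bool (holding a b y k) * (y (Suc k) - y k))"
  by (induction n) (use assms in \<open>auto simp: algebra_simps split: if_splits\<close>)

lemma upcrossings_le:
  assumes "a < b" "0 \<le> a" "\<And>k. 0 \<le> y k"
  shows "(b - a) * upcrossings a b y n
    \<le> a + (\<Sum>k<n. of_bool (holding a b y k) * (y (Suc k) - y k))"
  using upcrossings_gain[OF assms(1), of y n] assms(2) assms(3)[of n] by (auto split: if_splits)

lemma mono_upcrossings: "mono (upcrossings a b y)"
  by (rule monoI, rule lift_Suc_mono_le) auto

lemma holding_if_le:
  assumes "a < b" "y j \<le> a"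
  shows "holding a b y j"
  using assms by (cases j) auto

text \<open>A position is closed only by completing a passage. If none were completed after time
  \<open>m\<close>, it would still be open at time \<open>j - 1\<close>, and the value at
  \<open>j\<close> would then complete one.\<close>

lemma ex_upcrossing:
  assumes "holding a b y m" "m < j" "b \<le> y j"
  shows "\<exists>i. upcrossings a b y m < upcrossings a b y i"
proof (rule ccontr)
  assume no: "\<not> ?thesis"
  have "holding a b y (m + d)" for d
  proof (induction d)
    case (Suc d)
    have "upcrossings a b y (m + d) \<ge> upcrossings a b y m"
      using mono_upcrossings by (rule monoD) simp
    moreover have "\<not> upcrossings a b y m < upcrossings a b y (Suc (m + d))"
      using no by blast
    ultimately have "y (Suc (m + d)) < b"
      using Suc by (auto split: if_splits)
    with Suc show ?case by simp
  qed (use assms in simp)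
  from this[of "j - m - 1"] assms have "holding a b y (j - 1)" by simp
  moreover obtain i where "j = Suc i" using assms(2) by (cases j) auto
  ultimately have "upcrossings a b y (j - 1) < upcrossings a b y j"
    using assms(3) by simp
  moreover have "upcrossings a b y m \<le> upcrossings a b y (j - 1)"
    using mono_upcrossings assms by (intro monoD[of "upcrossings a b y"]) auto
  ultimately show False using no by (meson le_less_trans)
qed

text \<open>Infinitely many visits to each side allow one more passage to be appended: wait for a
  low value, then for a strictly later high one.\<close>

lemma upcrossings_unbounded:
  assumes "a < b" "\<exists>\<^sub>F k in sequentially. y k \<le> a" "\<exists>\<^sub>F k in sequentially. b \<le> y k"
  shows "\<exists>n. m \<le> upcrossings a b y n"
proof (induction m)
  case (Suc m)
  then obtain n where n: "m \<le> upcrossings a b y n" by blast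
  obtain i where i: "n \<le> i" "y i \<le> a"
    using assms(2) by (auto simp: frequently_sequentially)
  obtain j where j: "Suc i \<le> j" "b \<le> y j"
    using assms(3) by (auto simp: frequently_sequentially)
  have "upcrossings a b y n \<le> upcrossings a b y i"
    using mono_upcrossings i by (intro monoD[of "upcrossings a b y"]) auto
  moreover obtain l where "upcrossings a b y i < upcrossings a b y l"
    using ex_upcrossing[of a b y i j] holding_if_le[of a b y i] assms(1) i(2) j by auto
  ultimately show ?case using n by (intro exI[of _ l]) linarith
qed simp

text \<open>A gap between liminf and limsup contains two rational levels that are crossed infinitely
  often. Rational levels keep the exceptional null sets countable in the application, and
  \<open>0 \<le> p\<close> matches the sign condition of \<open>upcrossings_le\<close>. The frequent
  bound \<open>B\<close> only serves to exclude the limit infinity.\<close>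

lemma convergent_if_upcrossings_bounded:
  fixes y :: "nat \<Rightarrow> real"
  assumes nonneg: "\<And>k. 0 \<le> y k"
    and bound: "\<exists>\<^sub>F k in sequentially. y k \<le> B"
    and upcr: "\<And>p q :: rat. 0 \<le> p \<Longrightarrow> p < q \<Longrightarrow>
      \<exists>m. \<forall>n. upcrossings (of_rat p) (of_rat q) y n \<le> m"
  shows "\<exists>L. y \<longlonglongrightarrow> L"
proof -
  let ?z = "\<lambda>k. ereal (y k)"
  have lim0: "0 \<le> liminf ?z"
    by (rule Liminf_bounded) (simp add: nonneg)
  have "\<not> liminf ?z < limsup ?z"
  proof
    assume "liminf ?z < limsup ?z"
    then obtain p :: rat where p: "liminf ?z < real_of_rat p" "real_of_rat p < limsup ?z"
      using ereal_dense3 by blast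
    then obtain q :: rat where q: "ereal (real_of_rat p) < real_of_rat q" "real_of_rat q < limsup ?z"
      using ereal_dense3 by blast
    have pq: "p < q" using q(1) by (simp add: of_rat_less)
    have "0 \<le> ereal (real_of_rat p)" using lim0 p(1) by (meson le_less_trans less_imp_le)
    then have p0: "0 \<le> p" by simp
    have low: "\<exists>\<^sub>F k in sequentially. y k \<le> of_rat p"
    proof (rule ccontr)
      assume "\<not> ?thesis"
      then have "\<forall>\<^sub>F k in sequentially. ereal (of_rat p) \<le> ?z k"
        by (auto simp: not_frequently elim!: eventually_mono)
      then show False using Liminf_bounded[where F = sequentially and X = ?z and C = "ereal (of_rat p)"] p(1) by (simp add: not_le[symmetric])
    qed
    have high: "\<exists>\<^sub>F k in sequentially. of_rat q \<le> y k"
    proof (rule ccontr)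
      assume "\<not> ?thesis"
      then have "\<forall>\<^sub>F k in sequentially. ?z k \<le> ereal (of_rat q)"
        by (auto simp: not_frequently elim!: eventually_mono)
      then show False using Limsup_bounded[where F = sequentially and X = ?z and C = "ereal (of_rat q)"] q(2) by (simp add: not_le[symmetric])
    qed
    obtain m where "\<And>n. upcrossings (of_rat p) (of_rat q) y n \<le> m"
      using upcr[OF p0 pq] by blast
    then show False
      using upcrossings_unbounded[OF _ low high, of "Suc m"] pq
      by (metis not_less_eq_eq of_rat_less)
  qed
  then have eq: "limsup ?z = liminf ?z"
    using Liminf_le_Limsup[of sequentially ?z] by simp
  then have lim: "?z \<longlonglongrightarrow> liminf ?z"
    by (intro Liminf_eq_Limsup) auto
  \<comment> \<open>The sequence returns to values at most \<open>B\<close> infinitely often, so its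
    liminf cannot exceed \<open>B\<close>; the slack of 1 is harmless, as only finiteness is
    wanted.\<close>
  have "liminf ?z < ereal (B + 1)"
  proof (rule ccontr)
    assume "\<not> ?thesis"
    then have "ereal B < liminf ?z"
      by (metis ereal_less_eq(3) less_add_one less_le_trans linorder_not_le ereal_less(2) not_less)
    then have "\<forall>\<^sub>F k in sequentially. \<not> y k \<le> B"
      by (auto dest!: less_LiminfD elim!: eventually_mono)
    with bound show False by (simp add: frequently_def)
  qed
  with lim0 obtain l where "liminf ?z = ereal l"
    by (cases "liminf ?z") auto
  with lim show ?thesis by auto
qed

section \<open>Doob's convergence theorem for nonnegative supermartingales\<close>

text \<open>The supermartingale property is stated through integrals over sets of
  \<open>F k\<close>, which replaces conditional expectations. It is applied to the event of holding
  a position and to the whole space. The first bounds the mean number of upcrossings, the second the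
  means of \<open>Y k\<close>.\<close>

theorem (in prob_space) nonneg_supermartingale_convergence:
  fixes F :: "nat \<Rightarrow> 'a measure" and Y :: "nat \<Rightarrow> 'a \<Rightarrow> real"
  assumes subalg: "\<And>k. subalgebra M (F k)"
    and mono: "\<And>k. sets (F k) \<subseteq> sets (F (Suc k))"
    and adapted: "\<And>k. Y k \<in> borel_measurable (F k)"
    and nonneg: "\<And>k \<omega>. 0 \<le> Y k \<omega>"
    and int: "\<And>k. integrable M (Y k)"
    and super: "\<And>k A. A \<in> sets (F k) \<Longrightarrow>
      expectation (\<lambda>\<omega>. indicator A \<omega> * Y (Suc k) \<omega>) \<le> expectation (\<lambda>\<omega>. indicator A \<omega> * Y k \<omega>)"
  shows "AE \<omega> in M. \<exists>L. (\<lambda>k. Y k \<omega>) \<longlonglongrightarrow> L"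
proof -
  have spF: "space (F k) = space M" for k
    using subalg by (simp add: subalgebra_def)
  have Suc_meas: "f \<in> measurable (F (Suc k)) N" if "f \<in> measurable (F k) N" for f :: "'a \<Rightarrow> 'c" and k N
    using that mono[of k] by (auto simp: measurable_def spF)
  have YM[measurable]: "Y k \<in> borel_measurable M" for k
    using int by auto
  let ?path = "\<lambda>\<omega> k. Y k \<omega>"
  \<comment> \<open>Whether a position is held at time \<open>k\<close> is decided by the values up
    to time \<open>k\<close>, so this event lies in \<open>F k\<close> and is admissible in
    \<open>super\<close>.\<close>
  have hold_meas: "Measurable.pred (F k) (\<lambda>\<omega>. holding a b (?path \<omega>) k)" for a b k
  proof (induction k)
    case 0
    note adapted[measurable]
    show ?case by simp
  next
    case (Suc k)
    note adapted[measurable] Suc_meas[OF Suc.IH, measurable]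
    show ?case by simp
  qed
  have hold_M[measurable]: "Measurable.pred M (\<lambda>\<omega>. holding a b (?path \<omega>) k)" for a b k
    using measurable_from_subalg[OF subalg hold_meas] .
  have up_M[measurable]: "(\<lambda>\<omega>. upcrossings a b (?path \<omega>) k) \<in> measurable M (count_space UNIV)" for a b k
    by (induction k) simp_all
  have upcr: "AE \<omega> in M. \<exists>m. \<forall>n. upcrossings a b (?path \<omega>) n \<le> m" if ab: "0 \<le> a" "a < b" for a b
  proof -
    let ?u = "\<lambda>n \<omega>. upcrossings a b (?path \<omega>) n"
    let ?H = "\<lambda>k \<omega>. of_bool (holding a b (?path \<omega>) k) :: real"
    have intH: "integrable M (\<lambda>\<omega>. ?H k \<omega> * Y j \<omega>)" for k j
      by (rule Bochner_Integration.integrable_bound[OF int[of j]]) (auto simp: abs_mult)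
    have H_le: "expectation (\<lambda>\<omega>. ?H k \<omega> * Y (Suc k) \<omega>) \<le> expectation (\<lambda>\<omega>. ?H k \<omega> * Y k \<omega>)" for k
    proof -
      let ?A = "{\<omega> \<in> space M. holding a b (?path \<omega>) k}"
      have "?A \<in> sets (F k)"
        by (rule hold_meas[unfolded pred_def spF])
      moreover have "expectation (\<lambda>\<omega>. indicator ?A \<omega> * Y j \<omega>) = expectation (\<lambda>\<omega>. ?H k \<omega> * Y j \<omega>)" for j
        by (rule Bochner_Integration.integral_cong) auto
      ultimately show ?thesis using super[of ?A k] by simp
    qed
    \<comment> \<open>Every increment of the strategy has mean at most 0, so only the constant
      \<open>a\<close> survives; the bound does not depend on \<open>n\<close>.\<close>
    have u_le: "(\<integral>\<^sup>+\<omega>. ennreal ((b - a) * ?u n \<omega>) \<partial>M) \<le> ennreal a" for n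
    proof -
      let ?R = "\<lambda>\<omega>. a + (\<Sum>k<n. ?H k \<omega> * Y (Suc k) \<omega> - ?H k \<omega> * Y k \<omega>)"
      have R: "(b - a) * ?u n \<omega> \<le> ?R \<omega>" for \<omega>
        using upcrossings_le[OF ab(2,1), where y = "?path \<omega>" and n = n] nonneg by (simp add: algebra_simps)
      have intR: "integrable M ?R"
        using intH by auto
      have "(\<integral>\<^sup>+\<omega>. ennreal ((b - a) * ?u n \<omega>) \<partial>M) \<le> (\<integral>\<^sup>+\<omega>. ennreal (?R \<omega>) \<partial>M)"
        using R by (intro nn_integral_mono ennreal_leI)
      also have "\<dots> = ennreal (expectation ?R)"
      proof (rule nn_integral_eq_integral[OF intR], rule AE_I2)
        fix \<omega>
        have "0 \<le> (b - a) * ?u n \<omega>" using ab by simp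
        with R[of \<omega>] show "0 \<le> ?R \<omega>" by linarith
      qed
      also have "expectation ?R = a + (\<Sum>k<n. expectation (\<lambda>\<omega>. ?H k \<omega> * Y (Suc k) \<omega>) - expectation (\<lambda>\<omega>. ?H k \<omega> * Y k \<omega>))"
        using intH by (simp add: prob_space)
      also have "\<dots> \<le> a"
        using H_le by (simp add: sum_nonpos)
      finally show ?thesis by (simp add: ennreal_leI)
    qed
    \<comment> \<open>By monotone convergence the uniform bound passes to the supremum over
      \<open>n\<close>, which is therefore finite almost everywhere.\<close>
    let ?U = "\<lambda>\<omega>. SUP n. ennreal ((b - a) * ?u n \<omega>)"
    have "(\<integral>\<^sup>+\<omega>. ?U \<omega> \<partial>M) = (SUP n. \<integral>\<^sup>+\<omega>. ennreal ((b - a) * ?u n \<omega>) \<partial>M)"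
    proof (rule nn_integral_monotone_convergence_SUP)
      show "incseq (\<lambda>n \<omega>. ennreal ((b - a) * ?u n \<omega>))"
        using ab by (intro incseq_SucI le_funI ennreal_leI mult_left_mono) auto
    qed simp
    also have "\<dots> \<le> ennreal a" using u_le by (rule SUP_least)
    finally have "(\<integral>\<^sup>+\<omega>. ?U \<omega> \<partial>M) \<noteq> \<infinity>"
      unfolding infinity_ennreal_def by (rule neq_top_trans[OF ennreal_neq_top])
    then have "AE \<omega> in M. ?U \<omega> \<noteq> \<infinity>"
      by (intro nn_integral_PInf_AE) auto
    then show ?thesis
    proof eventually_elim
      case (elim \<omega>)
      then obtain r where r: "0 \<le> r" "?U \<omega> = ennreal r"
        by (cases "?U \<omega>") auto
      have "?u n \<omega> \<le> nat \<lceil>r / (b - a)\<rceil>" for n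
      proof -
        have "ennreal ((b - a) * ?u n \<omega>) \<le> ennreal r"
          unfolding r(2)[symmetric] by (rule SUP_upper) simp
        then have "(b - a) * ?u n \<omega> \<le> r" using r(1) by simp
        then have "real (?u n \<omega>) \<le> r / (b - a)" using ab by (simp add: field_simps)
        then show ?thesis by linarith
      qed
      then show ?case by blast
    qed
  qed
  \<comment> \<open>Countably many pairs of levels, so a single null set serves them all.\<close>
  have "AE \<omega> in M. \<forall>p q :: rat. 0 \<le> p \<longrightarrow> p < q \<longrightarrow>
      (\<exists>m. \<forall>n. upcrossings (of_rat p) (of_rat q) (?path \<omega>) n \<le> m)"
    unfolding AE_all_countable
    by (intro allI AE_impI upcr) (simp_all add: of_rat_less)
  \<comment> \<open>Fatou's lemma together with nonincreasing means. A finite liminf provides the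
    frequent bound needed for a finite limit.\<close>
  moreover have "AE \<omega> in M. liminf (\<lambda>k. ennreal (Y k \<omega>)) \<noteq> \<infinity>"
  proof (rule nn_integral_PInf_AE)
    have E_dec: "expectation (Y k) \<le> expectation (Y 0)" for k
    proof (induction k)
      case (Suc k)
      have "expectation (\<lambda>\<omega>. indicator (space M) \<omega> * Y j \<omega>) = expectation (Y j)" for j
        by (rule Bochner_Integration.integral_cong) auto
      then show ?case using super[of "space M" k] Suc spF sets.top[of "F k"] by simp
    qed simp
    have "(\<integral>\<^sup>+\<omega>. liminf (\<lambda>k. ennreal (Y k \<omega>)) \<partial>M) \<le> liminf (\<lambda>k. \<integral>\<^sup>+\<omega>. ennreal (Y k \<omega>) \<partial>M)"
      by (rule nn_integral_liminf) simp
    also have "\<dots> = liminf (\<lambda>k. ennreal (expectation (Y k)))"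
      using int nonneg by (simp add: nn_integral_eq_integral)
    also have "\<dots> \<le> liminf (\<lambda>k::nat. ennreal (expectation (Y 0)))"
      using E_dec by (intro Liminf_mono always_eventually allI ennreal_leI)
    also have "\<dots> < \<infinity>" by (simp add: Liminf_const)
    finally show "(\<integral>\<^sup>+\<omega>. liminf (\<lambda>k. ennreal (Y k \<omega>)) \<partial>M) \<noteq> \<infinity>" by simp
  qed simp
  ultimately show ?thesis
  proof eventually_elim
    case (elim \<omega>)
    from elim(2) obtain r where r: "0 \<le> r" "liminf (\<lambda>k. ennreal (Y k \<omega>)) = ennreal r"
      by (cases "liminf (\<lambda>k. ennreal (Y k \<omega>))") auto
    have "\<exists>\<^sub>F k in sequentially. Y k \<omega> \<le> r + 1"
    proof (rule ccontr)
      assume "\<not> ?thesis"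
      then have "\<forall>\<^sub>F k in sequentially. ennreal (r + 1) \<le> ennreal (Y k \<omega>)"
        by (auto simp: not_frequently elim!: eventually_mono intro!: ennreal_leI)
      then show False using Liminf_bounded[of "ennreal (r + 1)"] r by fastforce
    qed
    then show ?case
      using elim(1) nonneg by (intro convergent_if_upcrossings_bounded) auto
  qed
qed

section \<open>Products over independent \<sigma>-algebras\<close>

text \<open>The \<sigma>-algebras generated by \<open>f\<close> and \<open>g\<close> are contained
  in \<open>F\<close> and \<open>G\<close>. Since \<open>f\<close> and \<open>g\<close> are both
  real-valued, \<open>indep_var\<close> applies to them even when \<open>F\<close> and
  \<open>G\<close> come from variables of different types.\<close>

lemma (in prob_space) expectation_mult_indep_set:
  fixes f g :: "'a \<Rightarrow> real"
  assumes indep: "indep_set (sets F) (sets G)"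
    and sp: "space F = space M" "space G = space M"
    and meas: "f \<in> borel_measurable F" "g \<in> borel_measurable G"
    and int: "integrable M f" "integrable M g"
  shows "expectation (\<lambda>\<omega>. f \<omega> * g \<omega>) = expectation f * expectation g"
proof (rule indep_var_lebesgue_integral[OF _ int])
  have "sigma_sets (space M) {f -` A \<inter> space M |A. A \<in> sets borel} \<subseteq> sets F"
    using measurable_sets[OF meas(1)] by (auto simp: sp(1)[symmetric] intro!: sets.sigma_sets_subset)
  moreover have "sigma_sets (space M) {g -` A \<inter> space M |A. A \<in> sets borel} \<subseteq> sets G"
    using measurable_sets[OF meas(2)] by (auto simp: sp(2)[symmetric] intro!: sets.sigma_sets_subset)
  ultimately show "indep_var borel f borel g"
    using indep int unfolding indep_var_eq indep_sets2_eq by blast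
qed

section \<open>Effect of averaging one pair on sums over the coordinates\<close>

definition sumsq :: "real ^ 'n::finite \<Rightarrow> real" where
  "sumsq x = (\<Sum>i\<in>UNIV. (x $ i)\<^sup>2)"

text \<open>Only the coordinates \<open>i\<close> and \<open>j\<close> change. Taking \<phi> as the
  identity gives conservation of the coordinate sum, and taking it as the square gives the drop of
  the sum of squares.\<close>

lemma sum_average_pair:
  fixes \<phi> :: "real \<Rightarrow> real" and x :: "real ^ 'n::finite"
  assumes "i \<noteq> j"
  shows "(\<Sum>l\<in>UNIV. \<phi> (average_pair (i, j) x $ l)) =
    (\<Sum>l\<in>UNIV. \<phi> (x $ l)) + 2 * \<phi> ((x $ i + x $ j) / 2) - \<phi> (x $ i) - \<phi> (x $ j)"
proof -
  have "(\<Sum>l\<in>UNIV. \<phi> (average_pair (i, j) x $ l)) - (\<Sum>l\<in>UNIV. \<phi> (x $ l))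
    = (\<Sum>l\<in>UNIV. \<phi> (average_pair (i, j) x $ l) - \<phi> (x $ l))"
    by (simp add: sum_subtractf)
  also have "\<dots> = (\<Sum>l\<in>{i, j}. \<phi> (average_pair (i, j) x $ l) - \<phi> (x $ l))"
    by (rule sum.mono_neutral_right) (auto simp: average_pair_def)
  also have "\<dots> = 2 * \<phi> ((x $ i + x $ j) / 2) - \<phi> (x $ i) - \<phi> (x $ j)"
    using assms by (simp add: average_pair_def)
  finally show ?thesis by simp
qed

text \<open>Covers the diagonal pairs, so that the two lemmas that follow hold for every pair and
  sums may range over all of \<open>UNIV\<close>.\<close>

lemma average_pair_same: "average_pair (i, i) x = x"
  by (simp add: average_pair_def vec_eq_iff)

lemma sum_coords_average_pair: "(\<Sum>l\<in>UNIV. average_pair p x $ l) = (\<Sum>l\<in>UNIV. x $ l)"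
  using sum_average_pair[of "fst p" "snd p" "\<lambda>t. t" x] average_pair_same[of "fst p" x]
  by (cases p; cases "fst p = snd p") (simp_all add: field_simps)

lemma sumsq_average_pair:
  "sumsq (average_pair p x) = sumsq x - (x $ fst p - x $ snd p)\<^sup>2 / 2"
proof (cases "fst p = snd p")
  case True
  then show ?thesis using average_pair_same[of "fst p" x] by (cases p) simp
next
  case False
  then show ?thesis
    using sum_average_pair[of "fst p" "snd p" "\<lambda>t. t\<^sup>2" x] 
    by (simp add: sumsq_def field_simps power2_eq_square)
qed

text \<open>Expand the square. The diagonal contributes 0, so this is also the sum over ordered
  pairs of distinct indices.\<close>

lemma sum_pair_differences:
  fixes x :: "real ^ 'n::finite"
  shows "(\<Sum>p\<in>UNIV. (x $ fst p - x $ snd p)\<^sup>2) =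
    2 * real CARD('n) * sumsq x - 2 * (\<Sum>i\<in>UNIV. x $ i)\<^sup>2"
proof -
  have "(\<Sum>p\<in>UNIV. (x $ fst p - x $ snd p)\<^sup>2) =
      (\<Sum>i\<in>UNIV. \<Sum>j\<in>UNIV. (x $ i)\<^sup>2 + (x $ j)\<^sup>2 - 2 * (x $ i * x $ j))"
    by (simp add: sum.cartesian_product power2_diff UNIV_Times_UNIV case_prod_unfold algebra_simps)
  also have "\<dots> = 2 * real CARD('n) * sumsq x - 2 * (\<Sum>i\<in>UNIV. x $ i)\<^sup>2"
    by (simp add: sum.distrib sum_subtractf sumsq_def power2_eq_square[of "sum _ _"] sum_product
        flip: sum_distrib_left)
  finally show ?thesis .
qed

lemma card_distinct_pairs: "card {(i :: 'n::finite, j). i \<noteq> j} = CARD('n) * (CARD('n) - 1)"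
proof -
  have "{(i :: 'n, j). i \<noteq> j} = (SIGMA i:UNIV. UNIV - {i})" by auto
  then show ?thesis by (simp add: card_SigmaI card_Diff_singleton)
qed

section \<open>One-step decay of the chain relative to its past\<close>

context repeated_averaging_chain
begin

text \<open>Has exactly the form occurring in \<open>pick_indep_past\<close>, so that this
  assumption folds to a statement about \<open>past k\<close>.\<close>

definition past :: "nat \<Rightarrow> 'w measure" where
  "past k = vimage_algebra (space M) (\<lambda>\<omega>. \<lambda>i\<in>{..k}. X i \<omega>) (\<Pi>\<^sub>M i\<in>{..k}. borel)"

lemma space_past [simp]: "space (past k) = space M"
  by (simp add: past_def)

lemma X_measurable_past:
  assumes "i \<le> k"
  shows "X i \<in> borel_measurable (past k)"
proof -
  have "(\<lambda>\<omega>. \<lambda>i\<in>{..k}. X i \<omega>) \<in> measurable (past k) (\<Pi>\<^sub>M i\<in>{..k}. borel)"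
    unfolding past_def by (rule measurable_vimage_algebra1) (auto simp: space_PiM)
  from measurable_compose[OF this measurable_component_singleton[of i]] assms
  show ?thesis by simp
qed

text \<open>Measurability of the chain comes out of the independence assumption:
  \<open>indep_set\<close> demands that its members be events.\<close>

lemma subalgebra_past: "subalgebra M (past k)"
  using indep_setD_ev1[OF pick_indep_past[of k]] by (simp add: subalgebra_def past_def)

lemma sets_past_Suc: "sets (past k) \<subseteq> sets (past (Suc k))"
  unfolding past_def[of k]
  by (intro sets_image_in_sets measurable_restrict X_measurable_past) auto

lemma coord_measurable_past: "(\<lambda>\<omega>. X k \<omega> $ i) \<in> borel_measurable (past k)"
  by (rule borel_measurable_continuous_on[OF _ X_measurable_past]) (auto intro: continuous_intros)

lemma sumsq_measurable_past: "(\<lambda>\<omega>. sumsq (X k \<omega>)) \<in> borel_measurable (past k)"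
  unfolding sumsq_def by (intro borel_measurable_sum borel_measurable_power coord_measurable_past)

lemma sum_coords_X:
  assumes "\<omega> \<in> space M"
  shows "(\<Sum>i\<in>UNIV. X k \<omega> $ i) = (\<Sum>i\<in>UNIV. x0 $ i)"
  by (induction k) (use assms in \<open>simp_all add: start step sum_coords_average_pair\<close>)

text \<open>Each step subtracts half a square. This constant bound along every path is what makes
  the sums of squares integrable.\<close>

lemma sumsq_X_le:
  assumes "\<omega> \<in> space M"
  shows "sumsq (X k \<omega>) \<le> sumsq x0"
proof (induction k)
  case (Suc k)
  have "sumsq (X (Suc k) \<omega>) \<le> sumsq (X k \<omega>)" using assms by (simp add: step sumsq_average_pair)
  with Suc show ?case by simp
qed (use assms in \<open>simp add: start\<close>)

lemma integrable_sumsq: "integrable M (\<lambda>\<omega>. sumsq (X k \<omega>))"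
proof (rule integrable_const_bound)
  show "AE \<omega> in M. norm (sumsq (X k \<omega>)) \<le> sumsq x0"
    using sumsq_X_le by (intro AE_I2) (simp add: sumsq_def sum_nonneg)
  show "(\<lambda>\<omega>. sumsq (X k \<omega>)) \<in> borel_measurable M"
    by (rule measurable_from_subalg[OF subalgebra_past sumsq_measurable_past])
qed

lemma expectation_pick:
  assumes "2 \<le> CARD('n)"
  shows "expectation (\<lambda>\<omega>. of_bool (pick k \<omega> = p)) =
    (if fst p = snd p then 0 else 1 / (real CARD('n) * (real CARD('n) - 1)))"
proof -
  \<comment> \<open>\<open>pmf_of_set\<close> is the uniform distribution only on a nonempty set;
    this is where two coordinates are required.\<close>
  have ne: "{(i :: 'n, j). i \<noteq> j} \<noteq> {}"
  proof
    assume "{(i :: 'n, j). i \<noteq> j} = {}"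
    then have "card {(i :: 'n, j). i \<noteq> j} = 0" by simp
    then show False using assms unfolding card_distinct_pairs by simp
  qed
  have "expectation (\<lambda>\<omega>. of_bool (pick k \<omega> = p)) = expectation (\<lambda>\<omega>. indicat_real {p} (pick k \<omega>))"
    by (simp add: indicator_def)
  also have "\<dots> = integral\<^sup>L (distr M (count_space UNIV) (pick k)) (indicat_real {p})"
    by (rule integral_distr[symmetric, OF pick_measurable]) simp
  also have "\<dots> = pmf (pmf_of_set {(i, j). i \<noteq> j}) p"
    unfolding pick_uniform by (simp add: measure_pmf_single)
  also have "\<dots> = (if fst p = snd p then 0 else 1 / (real CARD('n) * (real CARD('n) - 1)))"
    using ne assms by (cases p) (simp add: pmf_of_set indicator_def card_distinct_pairs of_nat_diff)
  finally show ?thesis .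
qed

text \<open>The martingale identity, integrated over an event of the past. Given the past, each
  ordered pair of distinct indices has weight \<open>1 / (n * (n - 1))\<close>, and half the summed
  squared differences is \<open>n * sumsq\<close>, so the mean drop is the fraction
  \<open>1 / (n - 1)\<close> of the sum of squares.\<close>

lemma expectation_step:
  assumes n: "2 \<le> CARD('n)" and zero: "(\<Sum>i\<in>UNIV. x0 $ i) = 0"
    and A: "A \<in> sets (past k)"
  shows "expectation (\<lambda>\<omega>. indicator A \<omega> * sumsq (X (Suc k) \<omega>)) =
    (1 - 1 / (real CARD('n) - 1)) * expectation (\<lambda>\<omega>. indicator A \<omega> * sumsq (X k \<omega>))"
proof -
  let ?n = "real CARD('n)"
  let ?D = "\<lambda>p \<omega>. (X k \<omega> $ fst p - X k \<omega> $ snd p)\<^sup>2"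
  let ?S = "\<lambda>k \<omega>. indicator A \<omega> * sumsq (X k \<omega>)"
  have AM: "A \<in> events" using A subalgebra_past by (auto simp: subalgebra_def)
  have intS: "integrable M (?S j)" for j
    by (rule integrable_real_mult_indicator[OF AM integrable_sumsq, simplified mult.commute])
  have Dm: "?D p \<in> borel_measurable (past k)" for p
    by (intro borel_measurable_power borel_measurable_diff coord_measurable_past)
  have intD: "integrable M (?D p)" for p
  proof (rule Bochner_Integration.integrable_bound)
    show "integrable M (\<lambda>\<omega>. 2 * sumsq (X k \<omega>))" using integrable_sumsq by simp
    show "?D p \<in> borel_measurable M" by (rule measurable_from_subalg[OF subalgebra_past Dm])
    \<comment> \<open>The sum of squares after averaging along \<open>p\<close> is
      \<open>sumsq (X k \<omega>) - ?D p \<omega> / 2\<close>, which is nonnegative.\<close>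
    have "?D p \<omega> \<le> 2 * sumsq (X k \<omega>)" for \<omega>
      using sumsq_average_pair[of p "X k \<omega>"]
      by (smt (verit, best) field_sum_of_halves sum_nonneg sumsq_def zero_le_power2)
    then show "AE \<omega> in M. norm (?D p \<omega>) \<le> norm (2 * sumsq (X k \<omega>))"
      by (intro AE_I2) (simp add: order_trans[OF _ abs_ge_self])
  qed
  have intAD: "integrable M (\<lambda>\<omega>. indicator A \<omega> * ?D p \<omega>)" for p
    by (rule integrable_real_mult_indicator[OF AM intD, simplified mult.commute])
  \<comment> \<open>Splitting by the value of the pick turns the random pair into a finite sum over
    fixed pairs; independence is then used for each \<open>p\<close> separately.\<close>
  define c where "c p \<omega> = (of_bool (pick k \<omega> = p) :: real)" for p \<omega>
  let ?G = "vimage_algebra (space M) (pick k) (count_space UNIV)"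
  have cG: "c p \<in> borel_measurable ?G" for p
    unfolding c_def by (rule measurable_compose[OF measurable_vimage_algebra1]) auto
  have cM: "c p \<in> borel_measurable M" for p
    unfolding c_def by (rule measurable_compose[OF pick_measurable]) simp
  have intc: "integrable M (c p)" for p
    by (rule integrable_const_bound[where B=1]) (use cM in \<open>auto simp: c_def\<close>)
  have indep: "expectation (\<lambda>\<omega>. (indicator A \<omega> * ?D p \<omega>) * c p \<omega>) =
      expectation (\<lambda>\<omega>. indicator A \<omega> * ?D p \<omega>) * expectation (c p)" for p
    using A Dm by (intro expectation_mult_indep_set[OF pick_indep_past[of k, folded past_def] _ _ _ cG intAD intc])
       auto
  have intADc: "integrable M (\<lambda>\<omega>. (indicator A \<omega> * ?D p \<omega>) * c p \<omega>)" for p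
  proof (rule Bochner_Integration.integrable_bound[OF intAD[of p]])
    show "(\<lambda>\<omega>. (indicator A \<omega> * ?D p \<omega>) * c p \<omega>) \<in> borel_measurable M"
      using cM by (intro borel_measurable_times borel_measurable_integrable[OF intAD])
  qed (simp add: c_def)
  have "expectation (?S (Suc k)) =
      expectation (\<lambda>\<omega>. ?S k \<omega> - (\<Sum>p\<in>UNIV. (indicator A \<omega> * ?D p \<omega>) * c p \<omega>) / 2)"
  proof (rule Bochner_Integration.integral_cong[OF refl])
    fix \<omega> assume "\<omega> \<in> space M"
    have "(\<Sum>p\<in>UNIV. (indicator A \<omega> * ?D p \<omega>) * c p \<omega>) = indicator A \<omega> * ?D (pick k \<omega>) \<omega>"
      by (simp add: c_def of_bool_def if_distrib cong: if_cong)
    with \<open>\<omega> \<in> space M\<close> show "?S (Suc k) \<omega> = ?S k \<omega> - (\<Sum>p\<in>UNIV. (indicator A \<omega> * ?D p \<omega>) * c p \<omega>) / 2"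
      by (simp add: step sumsq_average_pair algebra_simps)
  qed
  also have "\<dots> = expectation (?S k) - (\<Sum>p\<in>UNIV. expectation (\<lambda>\<omega>. indicator A \<omega> * ?D p \<omega>) * expectation (c p)) / 2"
    using intS intADc indep by simp
  \<comment> \<open>Diagonal pairs have probability 0, but their squared difference is 0 as well, so
    all pairs may carry the common weight.\<close>
  also have "(\<Sum>p\<in>UNIV. expectation (\<lambda>\<omega>. indicator A \<omega> * ?D p \<omega>) * expectation (c p)) =
      (\<Sum>p\<in>UNIV. expectation (\<lambda>\<omega>. indicator A \<omega> * ?D p \<omega>)) / (?n * (?n - 1))"
    unfolding sum_divide_distrib by (rule sum.cong) (simp_all add: c_def[abs_def] expectation_pick[OF n])
  also have "(\<Sum>p\<in>UNIV. expectation (\<lambda>\<omega>. indicator A \<omega> * ?D p \<omega>)) =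
      expectation (\<lambda>\<omega>. \<Sum>p\<in>UNIV. indicator A \<omega> * ?D p \<omega>)"
    by (rule Bochner_Integration.integral_sum[symmetric]) (rule intAD)
  \<comment> \<open>The coordinate sum stays 0 along the chain, which removes the second term of
    \<open>sum_pair_differences\<close>.\<close>
  also have "\<dots> = expectation (\<lambda>\<omega>. 2 * ?n * ?S k \<omega>)"
    by (rule Bochner_Integration.integral_cong)
      (simp_all add: sum_pair_differences sum_coords_X zero flip: sum_distrib_left)
  also have "\<dots> = 2 * ?n * expectation (?S k)" by simp
  also have "2 * ?n * expectation (?S k) / (?n * (?n - 1)) / 2 = expectation (?S k) / (?n - 1)"
  proof -
    have cancel: "2 * x * e / (x * y) / 2 = e / y" if "x \<noteq> 0" for x y e :: real
      using that by simp
    show ?thesis by (rule cancel) simp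
  qed
  finally show ?thesis by (simp add: left_diff_distrib)
qed

text \<open>Iterates \<open>expectation_step\<close> with the whole space as the event.\<close>

lemma expectation_sumsq:
  assumes "2 \<le> CARD('n)" "(\<Sum>i\<in>UNIV. x0 $ i) = 0"
  shows "expectation (\<lambda>\<omega>. sumsq (X k \<omega>)) = (1 - 1 / (real CARD('n) - 1)) ^ k * sumsq x0"
proof (induction k)
  case 0
  have "expectation (\<lambda>\<omega>. sumsq (X 0 \<omega>)) = expectation (\<lambda>\<omega>. sumsq x0)"
    by (rule Bochner_Integration.integral_cong) (simp_all add: start)
  then show ?case by (simp add: prob_space)
next
  case (Suc k)
  have "expectation (\<lambda>\<omega>. indicator (space M) \<omega> * sumsq (X j \<omega>)) = expectation (\<lambda>\<omega>. sumsq (X j \<omega>))" for j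
    by (rule Bochner_Integration.integral_cong) auto
  then show ?case
    using expectation_step[OF assms, of "space M" k] Suc sets.top[of "past k"] by simp
qed

end

section \<open>Mean and almost sure limit of the rescaled sum of squares\<close>

theorem corollary2p2:
  fixes M :: "'w measure"
    and x0 :: "real ^ 'n::finite"
    and X :: "nat \<Rightarrow> 'w \<Rightarrow> real ^ 'n"
    and pick :: "nat \<Rightarrow> 'w \<Rightarrow> 'n \<times> 'n"
    and S :: "nat \<Rightarrow> 'w \<Rightarrow> real"
    and \<tau> :: real
  assumes "CARD('n) \<ge> 2"
    and "(\<Sum>i\<in>UNIV. x0 $ i) = 0"
    and "repeated_averaging_chain M x0 X pick"
    and "S = (\<lambda>k \<omega>. \<Sum>i\<in>UNIV. (X k \<omega> $ i)\<^sup>2)"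
    and "\<tau> = 1 - 1 / (real CARD('n) - 1)"
  shows "(\<forall>k. integrable M (S k) \<and>
             prob_space.expectation M (S k) = \<tau> ^ k * (\<Sum>i\<in>UNIV. (x0 $ i)\<^sup>2)) \<and>
         (AE \<omega> in M. \<exists>L::real. (\<lambda>k. S k \<omega> / \<tau> ^ k) \<longlonglongrightarrow> L)"
proof -
  interpret repeated_averaging_chain M x0 X pick by fact
  have S: "S = (\<lambda>k \<omega>. sumsq (X k \<omega>))"
    by (simp add: assms(4) sumsq_def)
  have "AE \<omega> in M. \<exists>L. (\<lambda>k. S k \<omega> / \<tau> ^ k) \<longlonglongrightarrow> L"
  proof (cases "\<tau> = 0")
    case True
    have "(\<lambda>k. S k \<omega> / \<tau> ^ k) \<longlonglongrightarrow> 0" for \<omega>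
      by (rule tendsto_eventually, rule eventually_mono[OF eventually_gt_at_top[of 0]])
        (simp add: True)
    then show ?thesis by blast
  next
    case False
    then have \<tau>: "0 < \<tau>"
      using assms(1) by (simp add: assms(5) field_simps)
    show ?thesis
    proof (rule nonneg_supermartingale_convergence[of past "\<lambda>k \<omega>. S k \<omega> / \<tau> ^ k"])
      show "(\<lambda>\<omega>. S k \<omega> / \<tau> ^ k) \<in> borel_measurable (past k)" for k
        unfolding S by (intro borel_measurable_divide sumsq_measurable_past borel_measurable_const)
      show "0 \<le> S k \<omega> / \<tau> ^ k" for k \<omega>
        using \<tau> by (simp add: assms(4) sum_nonneg)
      show "integrable M (\<lambda>\<omega>. S k \<omega> / \<tau> ^ k)" for k
        unfolding S by (intro integrable_divide_zero integrable_sumsq)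
      \<comment> \<open>The two sides are in fact equal: the factor \<tau> from
        \<open>expectation_step\<close> cancels the additional \<tau> in the denominator.\<close>
      show "expectation (\<lambda>\<omega>. indicator A \<omega> * (S (Suc k) \<omega> / \<tau> ^ Suc k))
          \<le> expectation (\<lambda>\<omega>. indicator A \<omega> * (S k \<omega> / \<tau> ^ k))"
        if "A \<in> sets (past k)" for k A
        using expectation_step[OF assms(1,2) that] \<tau> by (simp add: S flip: assms(5))
    qed (rule subalgebra_past sets_past_Suc)+
  qed
  moreover have "expectation (S k) = \<tau> ^ k * (\<Sum>i\<in>UNIV. (x0 $ i)\<^sup>2)" for k
    using expectation_sumsq[OF assms(1,2), of k] by (simp add: S assms(5) sumsq_def[of x0])
  moreover have "integrable M (S k)" for k
    unfolding S by (rule integrable_sumsq)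
  ultimately show ?thesis by blast
qed

end
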